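(* Let $L$ be a levellised $n$-lattice with $\mathrm{dep}_L(n-1)=k$, let $m$ be a positive integer, and let $A_i\subseteq L\setminus\{0\}$ for $i=n,\ldots,n+m-1$ satisfy: (i) $A_i\cap\mathrm{lev}_k(L)\neq\emptyset$ for all $i$; (ii) each $A_i$ is a lattice-antichain for $L$; (iii) whenever $n\le i<j<n+m$ and $a,b\in(\uparrow_L A_i)\cap(\uparrow_L A_j)$, one has $a\wedge_L b\neq0$. Then $L_{A_n,\ldots,A_{n+m-1}}$ is a canonical $(n+m)$-lattice if and only if (1) $L$ is canonical; and (2) the sequence $\mathrm{LWT}_L(A_n,\ldots,A_{n+m-1})$ is lexicographically minimal in its orbit under the action of $\mathrm{Stab}(L)\times\mathrm{Sym}(\{n,\ldots,n+m-1\})$ given by $\pi\big(\mathrm{LWT}_L(A_n,\ldots,A_{n+m-1})\big)=\mathrm{LWT}_L\big(\pi(A_{\pi^{-1}(n)}),\ldots,\pi(A_{\pi^{-1}(n+m-1)})\big)$.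
   Context: An $n$-poset ($n\ge2$) is a finite poset whose $n$ elements are labelled $0,1,\ldots,n-1$, where $0$ is the least element and $1$ is the greatest element; an $n$-lattice is an $n$-poset that is a lattice, with meet $\wedge_L$. $\uparrow_L A=\{x: a\preceq_L x\text{ for some }a\in A\}$. $\mathrm{cov}_L(a)$ is the set of elements covering $a$. The depth $\mathrm{dep}_L(a)$ is the integer $p$ such that $p+1$ is the maximum number of elements of a chain in $L$ with least element $a$ and greatest element $1$. $\mathrm{lev}_k(L)=\{a:\mathrm{dep}_L(a)=k\}$. $L$ is levellised if $\mathrm{dep}_L(i)\le\mathrm{dep}_L(j)$ whenever $0<i\le j<n$. $\mathrm{wt}(A)=\sum_{j\in A}2^j$; $\mathrm{cov}^d_L(i)=\mathrm{cov}_L(i)\cap\mathrm{lev}_d(L)$. A lattice-antichain for $L$ is a non-empty antichain $A\subseteq L\setminus\{0\}$ with $a\wedge_L b\in\{0\}\cup\uparrow_L A$ for all $a,b\in\uparrow_L A$. For $A\subseteq L\setminus\{0\}$, $L_A$ is the $(n+1)$-poset on $\{0,\ldots,n\}$ whose order is the reflexive-transitive closure of $\preceq_L$ together with $0\preceq n$ and $n\preceq a$ ($a\in A$); $L_{A_n,\ldots,A_{n+m-1}}=(\cdots(L_{A_n})\cdots)_{A_{n+m-1}}$. A relabelling by a permutation $\pi$ of the labels gives the poset $\pi(L)$ with $\pi(a)\preceq\pi(b)$ iff $a\preceq_L b$; $\mathrm{Stab}(L)=\{\pi\in\mathrm{Sym}(\{0,\ldots,n-1\}):\pi(L)=L\}$.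 Two $n$-lattices are isomorphic as unlabelled lattices if one is a relabelling of the other. For a levellised $n$-lattice $L$ with $n>2$ and $k=\mathrm{dep}_L(n-1)$, $L'$ is the subposet induced by the elements of depth $\neq k$. The relation $<$ on levellised $n$-lattices isomorphic as unlabelled lattices is defined by induction on $n$ (trivial for $n=2$): $L_1<L_2$ iff either $L_1'<L_2'$, or $L_1'=L_2'$ and, with $k=\mathrm{dep}_{L_1}(n-1)$ and $\mathrm{lev}_k(L_1)=\mathrm{lev}_k(L_2)=\{a_k,\ldots,n-1\}$, there exist $\ell\in\{1,\ldots,k-1\}$ and $i\in\{a_k,\ldots,n-1\}$ with $\mathrm{wt}(\mathrm{cov}^d_{L_1}(j))=\mathrm{wt}(\mathrm{cov}^d_{L_2}(j))$ whenever $d>\ell$, or $d=\ell$ and $j\in\{a_k,\ldots,i-1\}$, and $\mathrm{wt}(\mathrm{cov}^\ell_{L_1}(i))<\mathrm{wt}(\mathrm{cov}^\ell_{L_2}(i))$. An $n$-lattice is canonical if it is levellised and $<$-minimal among levellised $n$-lattices isomorphic to it as unlabelled lattices. For $d=1,\ldots,k$, $\mathrm{LWT}^d_L(A_n,\ldots,A_{n+m-1})$ is the sequence $\big(\mathrm{wt}(A_n\cap\mathrm{lev}_d(L)),\ldots,\mathrm{wt}(A_{n+m-1}\cap\mathrm{lev}_d(L))\big)$, and $\mathrm{LWT}_L(A_n,\ldots,A_{n+m-1})$ is the concatenation of $\mathrm{LWT}^k_L,\mathrm{LWT}^{k-1}_L,\ldots,\mathrm{LWT}^1_L$ (in this order)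 of $(A_n,\ldots,A_{n+m-1})$. Sequences of integers are compared lexicographically. *)

theory Defs
  imports
    "HOL-Algebra.Lattice"
    "HOL-Combinatorics.Permutations"
    "HOL-Library.List_Lexorder"
begin

text \<open>A poset is given by its order relation. This is reflexive on the carrier and contained in its
  square, so the carrier is the field of the relation, and two labelled posets are equal if and only
  if their relations are.\<close>

definition n_poset :: "nat \<Rightarrow> nat rel \<Rightarrow> bool" where
  "n_poset n L \<longleftrightarrow> n \<ge> 2 \<and> partial_order_on {..<n} L \<and> (\<forall>a<n. (0, a) \<in> L \<and> (a, 1) \<in> L)"

definition gorder_of :: "'a rel \<Rightarrow> 'a gorder" where
  "gorder_of L = \<lparr>carrier = Field L, eq = (=), le = (\<lambda>a b. (a, b) \<in> L)\<rparr>"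

definition n_lattice :: "nat \<Rightarrow> nat rel \<Rightarrow> bool" where
  "n_lattice n L \<longleftrightarrow> n_poset n L \<and> lattice (gorder_of L)"

abbreviation meet_in :: "'a rel \<Rightarrow> 'a \<Rightarrow> 'a \<Rightarrow> 'a" where
  "meet_in L a b \<equiv> a \<sqinter>\<^bsub>gorder_of L\<^esub> b"

abbreviation up_set :: "'a rel \<Rightarrow> 'a set \<Rightarrow> 'a set" where
  "up_set L A \<equiv> L `` A"

definition cov :: "'a rel \<Rightarrow> 'a \<Rightarrow> 'a set" where
  "cov L a = {b. (a, b) \<in> L \<and> a \<noteq> b \<and> (\<forall>c. (a, c) \<in> L \<and> (c, b) \<in> L \<longrightarrow> c = a \<or> c = b)}"

definition dep :: "nat rel \<Rightarrow> nat \<Rightarrow> nat" where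
  "dep L a = Max {card C | C. C \<in> Chains L \<and> a \<in> C \<and> 1 \<in> C \<and>
                              (\<forall>c\<in>C. (a, c) \<in> L \<and> (c, 1) \<in> L)} - 1"

definition lev :: "nat rel \<Rightarrow> nat \<Rightarrow> nat set" where
  "lev L k = {a \<in> Field L. dep L a = k}"

definition levellised :: "nat \<Rightarrow> nat rel \<Rightarrow> bool" where
  "levellised n L \<longleftrightarrow> (\<forall>i j. 0 < i \<and> i \<le> j \<and> j < n \<longrightarrow> dep L i \<le> dep L j)"

definition wt :: "nat set \<Rightarrow> nat" where
  "wt A = (\<Sum>j\<in>A. 2 ^ j)"

definition cov_lev :: "nat rel \<Rightarrow> nat \<Rightarrow> nat \<Rightarrow> nat set" where
  "cov_lev L d i = cov L i \<inter> lev L d"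

definition lattice_antichain :: "nat rel \<Rightarrow> nat set \<Rightarrow> bool" where
  "lattice_antichain L A \<longleftrightarrow> A \<noteq> {} \<and> A \<subseteq> Field L - {0} \<and>
     (\<forall>a\<in>A. \<forall>b\<in>A. (a, b) \<in> L \<longrightarrow> a = b) \<and>
     (\<forall>a\<in>up_set L A. \<forall>b\<in>up_set L A. meet_in L a b \<in> {0} \<union> up_set L A)"

text \<open>Since \<open>\<^sup>*\<close> is reflexive on the whole type, the closure is restricted to the new carrier.\<close>

definition add_elem :: "nat \<Rightarrow> nat rel \<Rightarrow> nat set \<Rightarrow> nat rel" where
  "add_elem n L A = Restr ((L \<union> {(0, n)} \<union> {n} \<times> A)\<^sup>*) {..n}"

primrec add_elems :: "nat \<Rightarrow> nat rel \<Rightarrow> (nat \<Rightarrow> nat set) \<Rightarrow> nat \<Rightarrow> nat rel" where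
  "add_elems n L A 0 = L"
| "add_elems n L A (Suc m) = add_elem (n + m) (add_elems n L A m) (A (n + m))"

definition relabel :: "('a \<Rightarrow> 'a) \<Rightarrow> 'a rel \<Rightarrow> 'a rel" where
  "relabel \<pi> L = map_prod \<pi> \<pi> ` L"

definition Stab :: "nat \<Rightarrow> nat rel \<Rightarrow> (nat \<Rightarrow> nat) set" where
  "Stab n L = {\<pi>. \<pi> permutes {..<n} \<and> relabel \<pi> L = L}"

definition isomorphic :: "nat \<Rightarrow> nat rel \<Rightarrow> nat rel \<Rightarrow> bool" where
  "isomorphic n L1 L2 \<longleftrightarrow> (\<exists>\<pi>. \<pi> permutes {..<n} \<and> relabel \<pi> L1 = L2)"

definition strip :: "nat \<Rightarrow> nat rel \<Rightarrow> nat rel" where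
  "strip n L = Restr L {a \<in> Field L. dep L a \<noteq> dep L (n - 1)}"

text \<open>The size of the carrier decreases from \<open>L\<close> to \<open>strip n L\<close>, so this inductive predicate is the
  unique solution of the recursive characterisation of the order on levellised \<open>n\<close>-lattices that are
  isomorphic as unlabelled lattices; for \<open>n = 2\<close> it is empty.\<close>

inductive lev_less :: "nat \<Rightarrow> nat rel \<Rightarrow> nat rel \<Rightarrow> bool" where
  strip_less:
    "lev_less n L1 L2"
    if "n > 2"
      and "n_lattice n L1" "levellised n L1" "n_lattice n L2" "levellised n L2"
      and "isomorphic n L1 L2"
      and "lev_less (card (Field (strip n L1))) (strip n L1) (strip n L2)"
| strip_eq:
    "lev_less n L1 L2"
    if "n > 2"
      and "n_lattice n L1" "levellised n L1" "n_lattice n L2" "levellised n L2"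
      and "isomorphic n L1 L2"
      and "strip n L1 = strip n L2"
      and "k = dep L1 (n - 1)"
      and "lev L1 k = {a..n - 1}" "lev L2 k = {a..n - 1}"
      and "l \<in> {1..k - 1}" "i \<in> {a..n - 1}"
      and "\<forall>d. \<forall>j\<in>{a..n - 1}. d > l \<or> (d = l \<and> j < i) \<longrightarrow>
             wt (cov_lev L1 d j) = wt (cov_lev L2 d j)"
      and "wt (cov_lev L1 l i) < wt (cov_lev L2 l i)"

definition canonical :: "nat \<Rightarrow> nat rel \<Rightarrow> bool" where
  "canonical n L \<longleftrightarrow> n_lattice n L \<and> levellised n L \<and>
     \<not> (\<exists>K. n_lattice n K \<and> levellised n K \<and> isomorphic n L K \<and> lev_less n K L)"

definition LWT_lev :: "nat \<Rightarrow> nat rel \<Rightarrow> nat \<Rightarrow> (nat \<Rightarrow> nat set) \<Rightarrow> nat \<Rightarrow> nat list" where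
  "LWT_lev n L m A d = map (\<lambda>i. wt (A i \<inter> lev L d)) [n..<n + m]"

definition LWT :: "nat \<Rightarrow> nat rel \<Rightarrow> nat \<Rightarrow> (nat \<Rightarrow> nat set) \<Rightarrow> nat list" where
  "LWT n L m A = concat (map (LWT_lev n L m A) (rev [1..<dep L (n - 1) + 1]))"

text \<open>A pair \<open>(\<sigma>, \<tau>)\<close> stands for the permutation that acts as \<open>\<sigma>\<close> on the labels of \<open>L\<close> and as
  \<open>\<tau>\<close> on the indices \<open>n, \<dots>, n + m - 1\<close>.\<close>

definition LWT_orbit :: "nat \<Rightarrow> nat rel \<Rightarrow> nat \<Rightarrow> (nat \<Rightarrow> nat set) \<Rightarrow> nat list set" where
  "LWT_orbit n L m A =
     {LWT n L m (\<lambda>i. \<sigma> ` A (inv \<tau> i)) | \<sigma> \<tau>. \<sigma> \<in> Stab n L \<and> \<tau> permutes {n..<n + m}}"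

end

(* Adding the elements n, ..., n+m-1 below the antichains A_i gives them depth k+1 and leaves the depth
   of every nonzero element of L unchanged; so the new elements form the last level, removing it gives
   back L, and the covers of the new element i are exactly A_i. Hence comparing two such extensions
   means comparing the underlying lattices first and then, if these coincide, the sequences LWT.
   A levellised relabelling of an extension must preserve the set of new labels, so it splits into a
   relabelling sigma of L and a permutation tau of the new labels, and the result is again an
   extension, of the relabelled L by the antichains sigma(A_(tau^-1(i))). Those relabellings with
   sigma(L) = L run through the orbit of the sequence LWT. *)

theory Submission
  imports Defs
begin

section \<open>Finite bounded posets and lattices\<close>

text \<open>Each hypothesis controls one feature of the extension. By (i) a new element has depth
  exactly k + 1, because no nonzero element of L is deeper than k. The antichain property makes A_i
  the set of minimal elements of its up-set, hence the set of covers of i. The closure condition in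
  (ii) and condition (iii) preserve meets: two old elements whose meet in L is 0 may acquire a new
  common lower bound, and this bound has to be unique. The element 0 stands apart. Its depth grows,
  since the new elements are inserted above it, but levellisedness does not look at it, the A_i
  avoid it, and it is fixed by every relabelling that leads from one labelled poset with bounds 0
  and 1 to another. Canonicity quantifies over all lattices isomorphic to the extension. Every one
  of them is a relabelling of it, so the competitors can be treated as permutations, and the
  question becomes which permutations give a levellised result.\<close>

lemma n_posetD:
  assumes "n_poset n L"
  shows "2 \<le> n" "partial_order_on {..<n} L"
    "\<And>a. a < n \<Longrightarrow> (a, a) \<in> L"
    "\<And>a b. (a, b) \<in> L \<Longrightarrow> a < n \<and> b < n"
    "\<And>a b c. (a, b) \<in> L \<Longrightarrow> (b, c) \<in> L \<Longrightarrow> (a, c) \<in> L"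
    "\<And>a b. (a, b) \<in> L \<Longrightarrow> (b, a) \<in> L \<Longrightarrow> a = b"
    "\<And>a. a < n \<Longrightarrow> (0, a) \<in> L" "\<And>a. a < n \<Longrightarrow> (a, 1) \<in> L"
    "\<And>a. (a, 0) \<in> L \<Longrightarrow> a = 0"
    "Field L = {..<n}"
proof -
  show n: "2 \<le> n" and po: "partial_order_on {..<n} L"
    and 0: "\<And>a. a < n \<Longrightarrow> (0, a) \<in> L" and "\<And>a. a < n \<Longrightarrow> (a, 1) \<in> L"
    using assms by (auto simp: n_poset_def)
  show r: "\<And>a. a < n \<Longrightarrow> (a, a) \<in> L" and f: "\<And>a b. (a, b) \<in> L \<Longrightarrow> a < n \<and> b < n"
    using partial_order_onD[OF po] by (auto simp: refl_on_def)
  show "\<And>a b c. (a, b) \<in> L \<Longrightarrow> (b, c) \<in> L \<Longrightarrow> (a, c) \<in> L"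
    using partial_order_onD(2)[OF po] by (auto dest: transD)
  show as: "\<And>a b. (a, b) \<in> L \<Longrightarrow> (b, a) \<in> L \<Longrightarrow> a = b"
    using partial_order_onD(3)[OF po] by (auto dest: antisymD)
  show "\<And>a. (a, 0) \<in> L \<Longrightarrow> a = 0" using as 0 f by blast
  show "Field L = {..<n}" using r f by (fastforce simp: Field_def)
qed

lemma n_posetI:
  assumes "2 \<le> n"
    and "\<And>a. a < n \<Longrightarrow> (a, a) \<in> L"
    and "\<And>a b. (a, b) \<in> L \<Longrightarrow> a < n \<and> b < n"
    and "\<And>a b c. (a, b) \<in> L \<Longrightarrow> (b, c) \<in> L \<Longrightarrow> (a, c) \<in> L"
    and "\<And>a b. (a, b) \<in> L \<Longrightarrow> (b, a) \<in> L \<Longrightarrow> a = b"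
    and "\<And>a. a < n \<Longrightarrow> (0, a) \<in> L" "\<And>a. a < n \<Longrightarrow> (a, 1) \<in> L"
  shows "n_poset n L"
proof -
  have "L \<subseteq> {..<n} \<times> {..<n}" using assms(3) by auto
  moreover have "refl_on {..<n} L" "trans L" "antisym L"
    using assms(2,4,5) by (auto simp: refl_on_def intro: antisymI transI)
  ultimately show ?thesis
    using assms(1,6,7) by (auto simp: n_poset_def partial_order_on_def preorder_on_def)
qed

definition glb :: "'a rel \<Rightarrow> 'a \<Rightarrow> 'a \<Rightarrow> 'a \<Rightarrow> bool" where
  "glb L a b g \<longleftrightarrow> (g, a) \<in> L \<and> (g, b) \<in> L \<and> (\<forall>c. (c, a) \<in> L \<and> (c, b) \<in> L \<longrightarrow> (c, g) \<in> L)"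

text \<open>In a finite poset with greatest element, the meet of all upper bounds of a pair is its join, so
  binary meets suffice for a lattice.\<close>

lemma finite_glb:
  assumes "n_poset n L" "\<And>a b. a < n \<Longrightarrow> b < n \<Longrightarrow> \<exists>g. glb L a b g"
    and "finite S" "S \<noteq> {}" "S \<subseteq> {..<n}"
  shows "\<exists>g<n. (\<forall>s\<in>S. (g, s) \<in> L) \<and> (\<forall>c. (\<forall>s\<in>S. (c, s) \<in> L) \<longrightarrow> (c, g) \<in> L)"
  using assms(3-5)
proof (induction S rule: finite_ne_induct)
  case (singleton x)
  then show ?case using n_posetD(3)[OF assms(1)] by auto
next
  case (insert x F)
  then obtain g where g: "g < n" "\<forall>s\<in>F. (g, s) \<in> L" "\<forall>c. (\<forall>s\<in>F. (c, s) \<in> L) \<longrightarrow> (c, g) \<in> L"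
    by auto
  then obtain h where "glb L x g h" using assms(2)[of x g] insert.prems by auto
  then have h: "(h, x) \<in> L" "(h, g) \<in> L" "\<And>c. (c, x) \<in> L \<Longrightarrow> (c, g) \<in> L \<Longrightarrow> (c, h) \<in> L"
    by (auto simp: glb_def)
  show ?case
  proof (intro exI[of _ h] conjI ballI allI impI)
    show "h < n" using h n_posetD(4)[OF assms(1)] by blast
    show "(h, s) \<in> L" if "s \<in> insert x F" for s
      using that h g n_posetD(5)[OF assms(1)] by blast
    show "(c, h) \<in> L" if "\<forall>s\<in>insert x F. (c, s) \<in> L" for c
      using that h g by blast
  qed
qed

lemma greatest_Lower_gorder_of_iff:
  assumes "n_poset n L" "x < n" "y < n"
  shows "greatest (gorder_of L) g (Lower (gorder_of L) {x, y}) \<longleftrightarrow> glb L x y g"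
  using n_posetD(4)[OF assms(1)] assms(2,3)
  by (auto simp: greatest_def Lower_def gorder_of_def glb_def n_posetD(10)[OF assms(1)])

lemma n_lattice_iff:
  "n_lattice n L \<longleftrightarrow> n_poset n L \<and> (\<forall>a<n. \<forall>b<n. \<exists>g. glb L a b g)"
proof (intro iffI conjI allI impI)
  show P: "n_poset n L" if "n_lattice n L" using that by (simp add: n_lattice_def)
  fix a b assume L: "n_lattice n L" and ab: "a < n" "b < n"
  then interpret lattice "gorder_of L" by (simp add: n_lattice_def)
  have "carrier (gorder_of L) = {..<n}" using n_posetD(10)[OF P[OF L]] by (simp add: gorder_of_def)
  then show "\<exists>g. glb L a b g"
    using inf_of_two_exists[of a b] greatest_Lower_gorder_of_iff[OF P[OF L] ab] ab by auto
next
  assume A: "n_poset n L \<and> (\<forall>a<n. \<forall>b<n. \<exists>g. glb L a b g)"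
  then have P: "n_poset n L" by simp
  note D = n_posetD[OF P]
  have po: "Order.partial_order (gorder_of L)"
    by unfold_locales (simp_all add: gorder_of_def D(10), (blast intro: D(3) D(5) D(6))+)
  have car: "carrier (gorder_of L) = {..<n}" using D(10) by (simp add: gorder_of_def)
  have lub: "\<exists>s. least (gorder_of L) s (Upper (gorder_of L) {x, y})" if xy: "x < n" "y < n" for x y
  proof -
    define U where "U = {u. (x, u) \<in> L \<and> (y, u) \<in> L}"
    have "U \<subseteq> {..<n}" "1 \<in> U" using D(4,8) xy by (auto simp: U_def)
    then obtain g where g: "g < n" "\<forall>s\<in>U. (g, s) \<in> L" "\<forall>c. (\<forall>s\<in>U. (c, s) \<in> L) \<longrightarrow> (c, g) \<in> L"
      using finite_glb[OF P, of U] A finite_subset[of U "{..<n}"] by blast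
    \<comment> \<open>Both x and y are lower bounds of \<open>U\<close>, so they lie below its
      greatest lower bound.\<close>
    have "(x, g) \<in> L" "(y, g) \<in> L" using g(3) by (auto simp: U_def)
    then have "least (gorder_of L) g (Upper (gorder_of L) {x, y})"
      using g xy unfolding least_def Upper_def U_def by (auto simp: gorder_of_def D(10))
    then show ?thesis by blast
  qed
  have "upper_semilattice (gorder_of L)"
    by (intro upper_semilattice.intro po upper_semilattice_axioms.intro) (auto simp: car lub)
  moreover have "lower_semilattice (gorder_of L)"
    by (intro lower_semilattice.intro po lower_semilattice_axioms.intro)
      (use A greatest_Lower_gorder_of_iff[OF P] in \<open>auto simp: car\<close>)
  ultimately show "n_lattice n L" by (simp add: n_lattice_def P Lattice.lattice_def)
qed

lemma glb_meet_in:
  assumes "n_lattice n L" "a < n" "b < n"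
  shows "glb L a b (meet_in L a b)"
proof -
  have P: "n_poset n L" using assms by (simp add: n_lattice_def)
  interpret lattice "gorder_of L" using assms by (simp add: n_lattice_def)
  have "carrier (gorder_of L) = {..<n}" using n_posetD(10)[OF P] by (simp add: gorder_of_def)
  then show ?thesis
    using inf_of_two_greatest[of a b] assms greatest_Lower_gorder_of_iff[OF P] by (simp add: meet_def)
qed

section \<open>Depth\<close>

text \<open>The chains over which \<open>dep\<close> maximises, as sets rather than cardinalities:
  depths in different orders are compared by comparing these sets.\<close>

definition chains_above :: "nat rel \<Rightarrow> nat \<Rightarrow> nat set set" where
  "chains_above L a = {C \<in> Chains L. a \<in> C \<and> 1 \<in> C \<and> (\<forall>c\<in>C. (a, c) \<in> L \<and> (c, 1) \<in> L)}"

lemma dep_eq_Max: "dep L a = Max (card ` chains_above L a) - 1"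
proof -
  have "{card C | C. C \<in> Chains L \<and> a \<in> C \<and> 1 \<in> C \<and> (\<forall>c\<in>C. (a, c) \<in> L \<and> (c, 1) \<in> L)}
      = card ` chains_above L a"
    by (auto simp: chains_above_def)
  then show ?thesis by (simp add: dep_def)
qed

lemma chains_above_subset:
  assumes "n_poset n L" "C \<in> chains_above L a"
  shows "C \<subseteq> {..<n}" "finite C"
proof -
  show "C \<subseteq> {..<n}" using assms n_posetD(4)[OF assms(1)] by (auto simp: chains_above_def)
  then show "finite C" by (rule finite_subset) simp
qed

lemma finite_chains_above: "n_poset n L \<Longrightarrow> finite (chains_above L a)"
  by (rule finite_subset[of _ "Pow {..<n}"]) (auto dest: chains_above_subset)

lemma card_le_dep:
  assumes "n_poset n L" "C \<in> chains_above L a"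
  shows "card C \<le> Suc (dep L a)"
proof -
  have "card C \<le> Max (card ` chains_above L a)"
    using assms finite_chains_above by (intro Max_ge) auto
  then show ?thesis by (simp add: dep_eq_Max)
qed

lemma longest_chain_above:
  assumes "n_poset n L" "a < n"
  obtains C where "C \<in> chains_above L a" "card C = Suc (dep L a)"
proof -
  have "{a, 1} \<in> chains_above L a"
    using n_posetD(1,3,8)[OF assms(1)] assms(2) by (auto simp: chains_above_def Chains_def)
  then have "Max (card ` chains_above L a) \<in> card ` chains_above L a"
    using finite_chains_above[OF assms(1)] by (intro Max_in) auto
  then obtain C where C: "C \<in> chains_above L a" "card C = Max (card ` chains_above L a)" by auto
  \<comment> \<open>Positivity makes the truncated subtraction in \<open>dep\<close> exact.\<close>
  have "card C > 0"
    using C(1) chains_above_subset[OF assms(1) C(1)] by (auto simp: card_gt_0_iff chains_above_def)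
  then show thesis using that[OF C(1)] C(2) by (simp add: dep_eq_Max)
qed

text \<open>Putting \<open>a\<close> below a longest chain from \<open>b\<close> to 1 gives a chain
  that is longer by one.\<close>

lemma dep_less:
  assumes "n_poset n L" "(a, b) \<in> L" "a \<noteq> b"
  shows "dep L b < dep L a"
proof -
  note D = n_posetD[OF assms(1)]
  obtain C where C: "C \<in> chains_above L b" "card C = Suc (dep L b)"
    using longest_chain_above[OF assms(1)] D(4)[OF assms(2)] by blast
  have "a \<notin> C" using C(1) D(6) assms by (auto simp: chains_above_def)
  moreover have "insert a C \<in> chains_above L a"
    using C(1) assms D(3,5) D(4)[OF assms(2)] D(8) unfolding chains_above_def Chains_def by blast
  ultimately show ?thesis
    using card_le_dep[OF assms(1), of "insert a C" a] chains_above_subset[OF assms(1) C(1)] C(2)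
    by simp
qed

text \<open>Removing \<open>a\<close> from a longest chain leaves \<open>dep L a\<close> elements.
  If any are left, they form a chain from their least element \<open>c\<close>, which lies strictly
  above \<open>a\<close>, so their number is at most \<open>dep L c + 1\<close>, hence at most
  \<open>d\<close>.\<close>

lemma dep_le:
  assumes "n_poset n L" "a < n" "\<And>b. (a, b) \<in> L \<Longrightarrow> b \<noteq> a \<Longrightarrow> dep L b < d"
  shows "dep L a \<le> d"
proof -
  note D = n_posetD[OF assms(1)]
  obtain C where C: "C \<in> chains_above L a" "card C = Suc (dep L a)"
    using longest_chain_above[OF assms(1,2)] .
  define C' where "C' = C - {a}"
  have fin: "finite C'" using chains_above_subset[OF assms(1) C(1)] by (simp add: C'_def)
  have card: "card C' = dep L a"
    using C chains_above_subset[OF assms(1) C(1)] by (simp add: C'_def chains_above_def)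
  show ?thesis
  proof (cases "C' = {}")
    case True
    then show ?thesis using card by simp
  next
    case False
    then have "Max (dep L ` C') \<in> dep L ` C'" using fin by (intro Max_in) auto
    then obtain c where c: "c \<in> C'" "\<And>x. x \<in> C' \<Longrightarrow> dep L x \<le> dep L c"
      using fin by (metis (no_types, lifting) Max_ge finite_imageI imageE imageI)
    have "(c, x) \<in> L" if "x \<in> C'" for x \<comment> \<open>an element of maximal depth is the least one of a chain\<close>
    proof -
      have "(c, x) \<in> L \<or> (x, c) \<in> L"
        using that c(1) C(1) by (auto simp: C'_def chains_above_def Chains_def)
      then show ?thesis using dep_less[OF assms(1), of x c] c(2)[OF that] by fastforce
    qed
    moreover have "1 \<in> C'"
    proof (rule ccontr)
      assume "1 \<notin> C'"
      then have "a = 1" using C(1) by (auto simp: C'_def chains_above_def)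
      then show False using c(1) C(1) D(6) by (auto simp: C'_def chains_above_def)
    qed
    ultimately have "C' \<in> chains_above L c"
      using c(1) C(1) by (auto simp: C'_def chains_above_def Chains_def)
    then have "card C' \<le> Suc (dep L c)" by (rule card_le_dep[OF assms(1)])
    moreover have "dep L c < d"
      using c(1) C(1) assms(3) by (auto simp: C'_def chains_above_def)
    ultimately show ?thesis using card by simp
  qed
qed

section \<open>Relabelling\<close>

lemma in_relabelI: "(a, b) \<in> L \<Longrightarrow> (\<pi> a, \<pi> b) \<in> relabel \<pi> L"
  unfolding relabel_def by (rule map_prod_imageI)

lemma in_relabelE:
  assumes "(x, y) \<in> relabel \<pi> L"
  obtains a b where "x = \<pi> a" "y = \<pi> b" "(a, b) \<in> L"
  using assms by (auto simp: relabel_def)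

lemma in_relabel_iff: "inj \<pi> \<Longrightarrow> (\<pi> a, \<pi> b) \<in> relabel \<pi> L \<longleftrightarrow> (a, b) \<in> L"
  by (metis in_relabelE in_relabelI injD)

lemma relabel_compose: "relabel (f \<circ> g) L = relabel f (relabel g L)"
  by (simp add: relabel_def image_image map_prod_def split_def)

lemma relabel_cong: "(\<And>x. x \<in> Field L \<Longrightarrow> f x = g x) \<Longrightarrow> relabel f L = relabel g L"
  unfolding relabel_def
proof (rule image_cong[OF refl])
  fix p assume "\<And>x. x \<in> Field L \<Longrightarrow> f x = g x" "p \<in> L"
  then show "map_prod f f p = map_prod g g p"
    by (cases p) (metis FieldI1 FieldI2 map_prod_simp)
qed

lemma relabel_id [simp]: "relabel id L = L"
  by (simp add: relabel_def map_prod.id)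

lemma relabel_inv:
  assumes "bij \<pi>" shows "relabel (inv \<pi>) (relabel \<pi> L) = L"
  using assms by (simp flip: relabel_compose add: bij_is_inj)

lemma Field_relabel: "Field (relabel \<pi> L) = \<pi> ` Field L"
  by (force simp: relabel_def Field_def)

text \<open>This inclusion holds for any map that fixes 1; applied to the inverse of a bijection it
  also yields the reverse inclusion.\<close>

lemma chains_above_relabel_subset:
  assumes "\<pi> 1 = 1"
  shows "(`) \<pi> ` chains_above L a \<subseteq> chains_above (relabel \<pi> L) (\<pi> a)"
proof safe
  fix C assume C: "C \<in> chains_above L a"
  have 1: "(\<pi> x, 1) \<in> relabel \<pi> L" if "(x, 1) \<in> L" for x
    using in_relabelI[OF that, of \<pi>] assms by simp
  have "\<pi> ` C \<in> Chains (relabel \<pi> L)"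
    using C in_relabelI[of _ _ L \<pi>] unfolding chains_above_def Chains_def by blast
  moreover have "1 \<in> \<pi> ` C" using C assms unfolding chains_above_def by (metis (lifting) image_eqI mem_Collect_eq)
  ultimately show "\<pi> ` C \<in> chains_above (relabel \<pi> L) (\<pi> a)"
    using C 1 unfolding chains_above_def by (auto intro: in_relabelI)
qed

lemma dep_relabel:
  assumes "bij \<pi>" "\<pi> 1 = 1"
  shows "dep (relabel \<pi> L) (\<pi> a) = dep L a"
proof -
  have inv: "inv \<pi> 1 = 1" "inv \<pi> (\<pi> a) = a"
    using assms inv_f_eq[OF bij_is_inj[OF assms(1)] assms(2)] by (simp_all add: bij_is_inj)
  have "chains_above (relabel \<pi> L) (\<pi> a) \<subseteq> (`) \<pi> ` chains_above L a"
  proof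
    fix C assume C: "C \<in> chains_above (relabel \<pi> L) (\<pi> a)"
    then have "inv \<pi> ` C \<in> chains_above L a"
      using chains_above_relabel_subset[of "inv \<pi>" "relabel \<pi> L" "\<pi> a"] inv
      by (auto simp: relabel_inv[OF assms(1)])
    moreover have "C = \<pi> ` inv \<pi> ` C" using assms by (simp add: bij_is_surj image_f_inv_f)
    ultimately show "C \<in> (`) \<pi> ` chains_above L a" by blast
  qed
  then have "chains_above (relabel \<pi> L) (\<pi> a) = (`) \<pi> ` chains_above L a"
    using chains_above_relabel_subset[of \<pi>, OF assms(2)] by (rule equalityI)
  moreover have "card (\<pi> ` C) = card C" for C
    using assms by (meson bij_is_inj card_image inj_on_subset subset_UNIV)
  ultimately show ?thesis by (simp add: dep_eq_Max image_image)
qed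

lemma lev_relabel:
  assumes "bij \<pi>" "\<pi> 1 = 1"
  shows "lev (relabel \<pi> L) d = \<pi> ` lev L d"
  using assms by (auto simp: lev_def Field_relabel dep_relabel)

lemma n_poset_relabel:
  assumes "n_poset n L" "\<pi> permutes {..<n}" "\<pi> 0 = 0" "\<pi> 1 = 1"
  shows "n_poset n (relabel \<pi> L)"
proof -
  note D = n_posetD[OF assms(1)]
  have inj: "inj \<pi>" using assms(2) by (rule permutes_inj)
  have lt: "\<pi> x < n \<longleftrightarrow> x < n" for x using permutes_in_image[OF assms(2), of x] by simp
  have ex: "\<exists>y. x = \<pi> y" for x using permutes_surj[OF assms(2)] by (metis surjD)
  show ?thesis
  proof (rule n_posetI)
    show "2 \<le> n" by (rule D)
    show "(a, a) \<in> relabel \<pi> L" if "a < n" for a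
      using that ex[of a] by (auto simp: in_relabel_iff[OF inj] lt D(3))
    show "a < n \<and> b < n" if "(a, b) \<in> relabel \<pi> L" for a b
      using that D(4) lt by (elim in_relabelE) auto
    show "(a, c) \<in> relabel \<pi> L" if "(a, b) \<in> relabel \<pi> L" "(b, c) \<in> relabel \<pi> L" for a b c
      using that ex[of a] ex[of b] ex[of c] D(5) by (auto simp: in_relabel_iff[OF inj])
    show "a = b" if "(a, b) \<in> relabel \<pi> L" "(b, a) \<in> relabel \<pi> L" for a b
      using that ex[of a] ex[of b] D(6) by (metis in_relabel_iff[OF inj])
    show "(0, a) \<in> relabel \<pi> L" if "a < n" for a
      using that ex[of a] in_relabel_iff[OF inj, of 0] D(7) assms(3) by (auto simp: lt)
    show "(a, 1) \<in> relabel \<pi> L" if "a < n" for a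
      using that ex[of a] in_relabel_iff[OF inj, of _ 1] D(8) assms(4) by (auto simp: lt)
  qed
qed

lemma n_lattice_relabel:
  assumes "n_lattice n L" "\<pi> permutes {..<n}" "\<pi> 0 = 0" "\<pi> 1 = 1"
  shows "n_lattice n (relabel \<pi> L)"
  unfolding n_lattice_iff
proof (intro conjI allI impI)
  show "n_poset n (relabel \<pi> L)"
    using assms by (simp add: n_poset_relabel n_lattice_def)
  have inj: "inj \<pi>" using assms(2) by (rule permutes_inj)
  have ex: "\<exists>y<n. x = \<pi> y" if "x < n" for x
    using that permutes_image[OF assms(2)] by auto
  fix a b assume "a < n" "b < n"
  then obtain x y where xy: "x < n" "y < n" "a = \<pi> x" "b = \<pi> y" using ex by metis
  obtain g where g: "glb L x y g" using assms(1) xy by (auto simp: n_lattice_iff)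
  have "glb (relabel \<pi> L) a b (\<pi> g)"
    unfolding glb_def
  proof (intro conjI allI impI)
    show "(\<pi> g, a) \<in> relabel \<pi> L" "(\<pi> g, b) \<in> relabel \<pi> L"
      using g by (auto simp: xy glb_def in_relabel_iff[OF inj])
    fix c assume c: "(c, a) \<in> relabel \<pi> L \<and> (c, b) \<in> relabel \<pi> L"
    obtain z where "c = \<pi> z" using permutes_surj[OF assms(2)] by (metis surjD)
    with c g show "(c, \<pi> g) \<in> relabel \<pi> L"
      by (auto simp: xy glb_def in_relabel_iff[OF inj])
  qed
  then show "\<exists>g. glb (relabel \<pi> L) a b g" by blast
qed

text \<open>Least and greatest elements are carried to least and greatest elements, and in both
  posets these have the labels 0 and 1. So stabilisers and isomorphisms of labelled lattices
  automatically fix 0 and 1.\<close>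

lemma permutes_fixes_bounds:
  assumes "n_poset n L" "n_poset n (relabel \<pi> L)" "\<pi> permutes {..<n}"
  shows "\<pi> 0 = 0" "\<pi> 1 = 1"
proof -
  note D = n_posetD[OF assms(1)] and E = n_posetD[OF assms(2)]
  have inj: "inj \<pi>" using assms(3) by (rule permutes_inj)
  have ex: "\<exists>y<n. x = \<pi> y" if "x < n" for x
    using that permutes_image[OF assms(3)] by auto
  obtain x y where xy: "x < n" "0 = \<pi> x" "y < n" "1 = \<pi> y" using ex[of 0] ex[of 1] D(1)
    by (metis One_nat_def Suc_1 Suc_le_eq less_trans_Suc zero_less_Suc less_SucI lessI less_le_trans)
  have "(\<pi> 0, \<pi> x) \<in> relabel \<pi> L" "(\<pi> y, \<pi> 1) \<in> relabel \<pi> L"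
    using in_relabelI[OF D(7)[OF xy(1)]] in_relabelI[OF D(8)[OF xy(3)]] .
  then show "\<pi> 0 = 0" "\<pi> 1 = 1"
    using E(9)[of "\<pi> 0"] E(6)[of "\<pi> 1" 1] E(8)[of "\<pi> 1"] E(4) xy by auto
qed

lemma isomorphic_sym:
  assumes "isomorphic n L K" shows "isomorphic n K L"
proof -
  obtain \<pi> where "\<pi> permutes {..<n}" "relabel \<pi> L = K" using assms by (auto simp: isomorphic_def)
  then show ?thesis
    unfolding isomorphic_def by (metis permutes_bij permutes_inv relabel_inv)
qed

section \<open>Lexicographic comparison of concatenated blocks\<close>

lemma append_less_append_iff:
  fixes xs ys xs' ys' :: "'a::order list"
  assumes "length xs = length xs'"
  shows "xs @ ys < xs' @ ys' \<longleftrightarrow> xs < xs' \<or> xs = xs' \<and> ys < ys'"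
  using assms by (induction xs xs' rule: list_induct2) auto

lemma map_upt_less_iff:
  fixes f g :: "nat \<Rightarrow> 'a::order"
  shows "map f [n..<n + m] < map g [n..<n + m] \<longleftrightarrow>
    (\<exists>i\<in>{n..<n + m}. (\<forall>j\<in>{n..<i}. f j = g j) \<and> f i < g i)"
proof (induction m)
  case (Suc m)
  have "map f [n..<n + Suc m] < map g [n..<n + Suc m] \<longleftrightarrow>
      map f [n..<n + m] < map g [n..<n + m] \<or>
      (\<forall>j\<in>{n..<n + m}. f j = g j) \<and> f (n + m) < g (n + m)"
    by (simp add: append_less_append_iff)
  also have "{n..<n + Suc m} = insert (n + m) {n..<n + m}" by auto
  ultimately show ?case using Suc.IH by auto
qed simp

text \<open>The right-hand side has the shape of the comparison in \<open>strip_eq\<close>: the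
  first difference sits at level l and position i. Since \<open>rev\<close> puts the highest level
  in front, each induction step on k splits off the leading block.\<close>

lemma concat_map_upt_less_iff:
  fixes f g :: "nat \<Rightarrow> nat \<Rightarrow> 'a::order"
  shows "concat (map (\<lambda>d. map (f d) [n..<n + m]) (rev [1..<k + 1])) <
         concat (map (\<lambda>d. map (g d) [n..<n + m]) (rev [1..<k + 1])) \<longleftrightarrow>
    (\<exists>l\<in>{1..k}. \<exists>i\<in>{n..<n + m}.
       (\<forall>d\<in>{1..k}. \<forall>j\<in>{n..<n + m}. l < d \<or> d = l \<and> j < i \<longrightarrow> f d j = g d j) \<and> f l i < g l i)"
    (is "?lhs k \<longleftrightarrow> ?rhs k")
proof (induction k)
  case (Suc k)
  have I: "{1..Suc k} = insert (Suc k) {1..k}" by auto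
  have "?lhs (Suc k) \<longleftrightarrow> map (f (Suc k)) [n..<n + m] < map (g (Suc k)) [n..<n + m] \<or>
      (\<forall>j\<in>{n..<n + m}. f (Suc k) j = g (Suc k) j) \<and> ?lhs k"
    by (simp add: append_less_append_iff)
  also have "\<dots> \<longleftrightarrow> ?rhs (Suc k)" (is "?a \<or> ?b \<longleftrightarrow> _")
  proof
    assume "?a \<or> ?b"
    then show "?rhs (Suc k)"
    proof
      assume ?a
      then obtain i where "i \<in> {n..<n + m}" "\<forall>j\<in>{n..<i}. f (Suc k) j = g (Suc k) j"
          "f (Suc k) i < g (Suc k) i"
        unfolding map_upt_less_iff by blast
      then show ?thesis by (intro bexI[of _ "Suc k"] bexI[of _ i]) auto
    next
      assume b: ?b
      then obtain l i where "l \<in> {1..k}" "i \<in> {n..<n + m}" "f l i < g l i"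
          "\<forall>d\<in>{1..k}. \<forall>j\<in>{n..<n + m}. l < d \<or> d = l \<and> j < i \<longrightarrow> f d j = g d j"
        unfolding Suc.IH by blast
      then show ?thesis using b unfolding I by (intro bexI[of _ l] bexI[of _ i]) auto
    qed
  next
    assume "?rhs (Suc k)"
    then obtain l i where li: "l \<in> {1..Suc k}" "i \<in> {n..<n + m}" "f l i < g l i"
        "\<forall>d\<in>{1..Suc k}. \<forall>j\<in>{n..<n + m}. l < d \<or> d = l \<and> j < i \<longrightarrow> f d j = g d j"
      by blast
    show "?a \<or> ?b"
    proof (cases "l = Suc k")
      case True
      then have ?a unfolding map_upt_less_iff
        using li bspec[OF li(4), of "Suc k"] by (intro bexI[of _ i]) auto
      then show ?thesis ..
    next
      case False
      then have "l \<in> {1..k}" using li by auto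
      then have "?rhs k" using li by (intro bexI[of _ l] bexI[of _ i]) auto
      moreover have "\<forall>j\<in>{n..<n + m}. f (Suc k) j = g (Suc k) j"
        using bspec[OF li(4), of "Suc k"] \<open>l \<in> {1..k}\<close> by auto
      ultimately show ?thesis using Suc.IH by blast
    qed
  qed
  finally show ?case .
qed simp

section \<open>Adding a level\<close>

text \<open>A closed form for the iterated closures in \<open>add_elems\<close>. The antichains
  consist of old elements, so no new element is below another: above a new i lie only i and the
  up-set of A_i in L.\<close>

definition ext :: "nat \<Rightarrow> nat \<Rightarrow> nat rel \<Rightarrow> (nat \<Rightarrow> nat set) \<Rightarrow> nat rel" where
  "ext n m L A = L \<union> {0} \<times> {n..<n + m} \<union> (\<Union>i\<in>{n..<n + m}. {i} \<times> insert i (L `` A i))"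

lemma in_ext_iff:
  "(x, y) \<in> ext n m L A \<longleftrightarrow>
    (x, y) \<in> L \<or> x = 0 \<and> y \<in> {n..<n + m} \<or> x \<in> {n..<n + m} \<and> (y = x \<or> y \<in> L `` A x)"
  by (auto simp: ext_def)

lemma up_set_nonzero:
  assumes "n_poset n L" "B \<subseteq> {..<n} - {0}" "x \<in> L `` B"
  shows "x < n" "x \<noteq> 0" "\<And>y. (x, y) \<in> L \<Longrightarrow> y \<in> L `` B"
proof -
  obtain a where a: "a \<in> B" "(a, x) \<in> L" using assms(3) by blast
  then show "x < n" "x \<noteq> 0"
    using n_posetD(4,9)[OF assms(1)] assms(2) by auto
  show "y \<in> L `` B" if "(x, y) \<in> L" for y
    using a that n_posetD(5)[OF assms(1)] by blast
qed

lemma n_poset_ext: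
  assumes "n_poset n L" and A: "\<And>i. i \<in> {n..<n + m} \<Longrightarrow> A i \<subseteq> {..<n} - {0}"
    and ne: "\<And>i. i \<in> {n..<n + m} \<Longrightarrow> A i \<noteq> {}"
  shows "n_poset (n + m) (ext n m L A)"
proof (rule n_posetI)
  note D = n_posetD[OF assms(1)] and U = up_set_nonzero[OF assms(1) A]
  show "2 \<le> n + m" using D(1) by simp
  show "(a, a) \<in> ext n m L A" if "a < n + m" for a
    using that D(3)[of a] by (auto simp: in_ext_iff)
  show ab: "a < n + m \<and> b < n + m" if "(a, b) \<in> ext n m L A" for a b
    using that D(1,4) U(1) by (fastforce simp: in_ext_iff)
  show "(a, c) \<in> ext n m L A" if "(a, b) \<in> ext n m L A" "(b, c) \<in> ext n m L A" for a b c
  proof (cases "b < n")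
    case True
    then have bc: "(b, c) \<in> L \<or> b = 0 \<and> c \<in> {n..<n + m}" using that by (auto simp: in_ext_iff)
    have ab: "(a, b) \<in> L \<or> a \<in> {n..<n + m} \<and> b \<in> L `` A a"
      using that True by (auto simp: in_ext_iff)
    show ?thesis
    proof (cases "b = 0")
      case True
      \<comment> \<open>Nothing but 0 is below 0, so a = b and the claim is the second
        assumption.\<close>
      then show ?thesis using ab D(9) U(2) that by blast
    next
      case False
      then show ?thesis using ab bc D(5) U(3) unfolding in_ext_iff by blast
    qed
  next
    case False
    then have "a = 0 \<or> a = b" using that(1) D(4) U(1) by (auto simp: in_ext_iff)
    then show ?thesis
      using that ab[OF that(2)] D(7)[of c] by (cases "c < n") (auto simp: in_ext_iff)
  qed
  show "a = b" if "(a, b) \<in> ext n m L A" "(b, a) \<in> ext n m L A" for a b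
  proof -
    have *: "x = 0 \<or> x = y" if "(x, y) \<in> ext n m L A" "n \<le> y" for x y
      using that D(4) U(1) by (fastforce simp: in_ext_iff)
    show ?thesis
    proof (cases "a < n \<and> b < n")
      case True
      then have "(a, b) \<in> L" "(b, a) \<in> L" using that by (auto simp: in_ext_iff)
      then show ?thesis by (rule D(6))
    next
      case False
      then consider "n \<le> b" | "n \<le> a" by linarith
      then show ?thesis
      proof cases
        case 1
        then show ?thesis using *[OF that(1)] that(2) D(1) D(9)[of b] U(2)[of b 0]
          by (auto simp: in_ext_iff)
      next
        case 2
        then show ?thesis using *[OF that(2)] that(1) D(1) D(9)[of a] U(2)[of a 0]
          by (auto simp: in_ext_iff)
      qed
    qed
  qed
  show "(0, a) \<in> ext n m L A" if "a < n + m" for a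
    using that D(7)[of a] by (auto simp: in_ext_iff)
  show "(a, 1) \<in> ext n m L A" if "a < n + m" for a
  proof (cases "a < n")
    case False
    then have "a \<in> {n..<n + m}" using that by simp
    then obtain x where "x \<in> A a" "x < n" using A ne by blast
    then show ?thesis using False that D(8) by (auto simp: in_ext_iff)
  qed (use D(8) in \<open>simp add: in_ext_iff\<close>)
qed

text \<open>The closed form is already transitive and contains the generating pairs, so it absorbs
  their closure. Conversely, each of its pairs is a generator, a reflexive pair or a path from the
  new element through a member of its antichain.\<close>

lemma add_elems_eq_ext:
  assumes "n_poset n L" "\<And>i. i \<in> {n..<n + m} \<Longrightarrow> A i \<subseteq> {..<n} - {0}"
    and "\<And>i. i \<in> {n..<n + m} \<Longrightarrow> A i \<noteq> {}"
  shows "add_elems n L A m = ext n m L A"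
  using assms(2,3)
proof (induction m)
  case (Suc m)
  note D = n_posetD[OF assms(1)]
  have IH: "add_elems n L A m = ext n m L A"
    using Suc.prems by (intro Suc.IH) auto
  have P: "n_poset (n + m) (ext n m L A)" and P': "n_poset (n + Suc m) (ext n (Suc m) L A)"
    using Suc.prems by (intro n_poset_ext[OF assms(1)]; force)+
  define G where "G = ext n m L A \<union> {(0, n + m)} \<union> {n + m} \<times> A (n + m)"
  have Am: "A (n + m) \<subseteq> {..<n} - {0}" using Suc.prems by simp
  have ext_Suc: "ext n (Suc m) L A =
      ext n m L A \<union> {(0, n + m)} \<union> {n + m} \<times> insert (n + m) (L `` A (n + m))"
    by (auto simp: in_ext_iff less_Suc_eq)
  have "G \<subseteq> ext n (Suc m) L A"
    unfolding G_def ext_Suc using Am D(3) by blast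
  then have "G\<^sup>* \<subseteq> (ext n (Suc m) L A)\<^sup>*" by (rule rtrancl_mono)
  also have "\<dots> = (ext n (Suc m) L A)\<^sup>="
    using n_posetD(5)[OF P'] by (subst rtrancl_trancl_reflcl, subst trancl_id) (auto intro: transI)
  \<comment> \<open>The closure adds identity pairs on the whole type; restriction leaves only those
    on the carrier, where \<open>ext\<close> is reflexive.\<close>
  finally have 1: "Restr (G\<^sup>*) {..n + m} \<subseteq> ext n (Suc m) L A"
    using n_posetD(3)[OF P'] by auto
  have "(n + m, x) \<in> G\<^sup>*" if "x \<in> L `` A (n + m)" for x
  proof -
    obtain a where "a \<in> A (n + m)" "(a, x) \<in> L"
      using \<open>x \<in> L `` A (n + m)\<close> by blast
    then have "(n + m, a) \<in> G" "(a, x) \<in> G" by (auto simp: G_def in_ext_iff)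
    then show ?thesis by (meson rtrancl.simps r_into_rtrancl)
  qed
  then have "ext n (Suc m) L A \<subseteq> G\<^sup>*" unfolding ext_Suc by (auto simp: G_def)
  moreover have "ext n (Suc m) L A \<subseteq> {..n + m} \<times> {..n + m}"
    using n_posetD(4)[OF P'] by fastforce
  ultimately have "Restr (G\<^sup>*) {..n + m} = ext n (Suc m) L A" using 1 by blast
  then show ?case by (simp add: IH add_elem_def G_def)
qed (simp add: ext_def)

text \<open>The meet g of two old elements changes only if g = 0 and some new i lies below both;
  then i becomes the meet. In every other case a new common lower bound is still below g.\<close>

lemma n_lattice_ext:
  assumes L: "n_lattice n L"
    and A: "\<And>i. i \<in> {n..<n + m} \<Longrightarrow> A i \<subseteq> {..<n} - {0}"
    and anti: "\<And>i. i \<in> {n..<n + m} \<Longrightarrow> lattice_antichain L (A i)"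
    and meet: "\<And>i j a b. n \<le> i \<Longrightarrow> i < j \<Longrightarrow> j < n + m \<Longrightarrow>
           a \<in> up_set L (A i) \<inter> up_set L (A j) \<Longrightarrow> b \<in> up_set L (A i) \<inter> up_set L (A j) \<Longrightarrow>
           meet_in L a b \<noteq> 0"
  shows "n_lattice (n + m) (ext n m L A)"
proof -
  have P: "n_poset n L" using L by (simp add: n_lattice_def)
  note D = n_posetD[OF P] and U = up_set_nonzero[OF P A]
  have P': "n_poset (n + m) (ext n m L A)"
    using A anti by (intro n_poset_ext P) (auto simp: lattice_antichain_def)
  have low: "(c, x) \<in> ext n m L A \<longleftrightarrow> (c, x) \<in> L \<or> c \<in> {n..<n + m} \<and> x \<in> L `` A c"
    if "x < n" for c x
    using that by (auto simp: in_ext_iff)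
  have lown: "(c, x) \<in> ext n m L A \<longleftrightarrow> c = 0 \<or> c = x" if "x \<in> {n..<n + m}" for c x
    using that D(4)[of c x] U(1)[of c x] by (auto simp: in_ext_iff)
  have old: "\<exists>g. glb (ext n m L A) a b g" if ab: "a < n" "b < n" for a b
  proof -
    define g where "g = meet_in L a b"
    have g: "(g, a) \<in> L" "(g, b) \<in> L" "\<And>c. (c, a) \<in> L \<Longrightarrow> (c, b) \<in> L \<Longrightarrow> (c, g) \<in> L"
      using glb_meet_in[OF L ab] by (auto simp: g_def glb_def)
    show ?thesis
    proof (cases "\<exists>i\<in>{n..<n + m}. a \<in> L `` A i \<and> b \<in> L `` A i \<and> g = 0")
      case True
      then obtain i where i: "i \<in> {n..<n + m}" "a \<in> L `` A i" "b \<in> L `` A i" "g = 0" by blast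
      have "glb (ext n m L A) a b i"
        unfolding glb_def
      proof (intro conjI allI impI)
        show "(i, a) \<in> ext n m L A" "(i, b) \<in> ext n m L A" using i by (auto simp: in_ext_iff)
        fix c assume c: "(c, a) \<in> ext n m L A \<and> (c, b) \<in> ext n m L A"
        have "c = i \<or> (c, g) \<in> L"
        proof (cases "c < n")
          case True
          then show ?thesis
            using c g(3) low[OF ab(1), of c] low[OF ab(2), of c] by (auto simp: in_ext_iff)
        next
          case False
          then have cc: "c \<in> {n..<n + m}" "a \<in> L `` A c" "b \<in> L `` A c"
            using c low[OF ab(1), of c] low[OF ab(2), of c] D(4) by auto
          \<comment> \<open>Two distinct new lower bounds c and i would force g to be nonzero by
            \<open>meet\<close>.\<close>
          show ?thesis
          proof (rule ccontr)
            assume "\<not> ?thesis"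
            then have "c < i \<or> i < c" by auto
            then show False
              using meet[of c i a b] meet[of i c a b] cc i by (auto simp: g_def)
          qed
        qed
        then show "(c, i) \<in> ext n m L A" using lown[OF i(1)] i(4) D(9) by auto
      qed
      then show ?thesis by blast
    next
      case False
      have "glb (ext n m L A) a b g"
        unfolding glb_def
      proof (intro conjI allI impI)
        show "(g, a) \<in> ext n m L A" "(g, b) \<in> ext n m L A" using g by (auto simp: in_ext_iff)
        fix c assume c: "(c, a) \<in> ext n m L A \<and> (c, b) \<in> ext n m L A"
        show "(c, g) \<in> ext n m L A"
        proof (cases "c < n")
          case True
          then show ?thesis
            using c g(3) low[OF ab(1), of c] low[OF ab(2), of c] by (auto simp: in_ext_iff)
        next
          case F: False
          then have cc: "c \<in> {n..<n + m}" "a \<in> L `` A c" "b \<in> L `` A c"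
            using c low[OF ab(1), of c] low[OF ab(2), of c] D(4) by auto
          \<comment> \<open>This is the closure condition of a lattice-antichain; the value 0 is
            excluded in the present case.\<close>
          have "g \<in> {0} \<union> L `` A c"
            using anti[OF cc(1)] cc(2,3) by (simp add: lattice_antichain_def g_def)
          then show ?thesis using False cc by (auto simp: in_ext_iff)
        qed
      qed
      then show ?thesis by blast
    qed
  qed
  \<comment> \<open>Below a new element there are only 0 and the element itself, so the meet is one
    of these two.\<close>
  have new: "\<exists>g. glb (ext n m L A) a b g" if "a \<in> {n..<n + m}" "b < n + m" for a b
  proof (cases "(a, b) \<in> ext n m L A")
    case True
    then have "glb (ext n m L A) a b a"
      using that n_posetD(3)[OF P', of a] by (auto simp: glb_def)
    then show ?thesis ..
  next
    case False
    then have "glb (ext n m L A) a b 0"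
      using that lown[OF that(1)] n_posetD(7)[OF P'] by (auto simp: glb_def)
    then show ?thesis ..
  qed
  have sym: "glb K b a g \<longleftrightarrow> glb K a b g" for K :: "nat rel" and a b g
    by (auto simp: glb_def)
  have "\<exists>g. glb (ext n m L A) a b g" if "a < n + m" "b < n + m" for a b
    using old[of a b] new[of a b] new[of b a] that by (cases "a < n"; cases "b < n") (auto simp: sym)
  then show ?thesis using P' by (simp add: n_lattice_iff)
qed

text \<open>Levellisedness of \<open>L\<close> is weakened here to a bound on the depths, so that the assumptions
  are invariant under arbitrary relabellings that fix 0 and 1.\<close>

locale extension =
  fixes n m k :: nat and L :: "nat rel" and A :: "nat \<Rightarrow> nat set"
  assumes poset: "n_poset n L"
    and m_pos: "0 < m"
    and A_subset: "\<And>i. i \<in> {n..<n + m} \<Longrightarrow> A i \<subseteq> {..<n} - {0}"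
    and A_antichain: "\<And>i a b. i \<in> {n..<n + m} \<Longrightarrow> a \<in> A i \<Longrightarrow> b \<in> A i \<Longrightarrow> (a, b) \<in> L \<Longrightarrow> a = b"
    and A_lev: "\<And>i. i \<in> {n..<n + m} \<Longrightarrow> A i \<inter> lev L k \<noteq> {}"
    and dep_bound: "\<And>j. 0 < j \<Longrightarrow> j < n \<Longrightarrow> dep L j \<le> k"
begin

abbreviation "N \<equiv> ext n m L A"

lemmas L = n_posetD[OF poset]
  and up = up_set_nonzero[OF poset A_subset]

section \<open>Depths, levels and covers in the extension\<close>

lemma poset_N: "n_poset (n + m) N"
  using A_subset A_lev by (intro n_poset_ext poset) blast+

lemmas ND = n_posetD[OF poset_N]

text \<open>Above a nonzero old element the order is unchanged, hence so are the chains from it to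
  1. For 0 this fails, as the new elements lie above it.\<close>

lemma dep_old:
  assumes "0 < a" "a < n" shows "dep N a = dep L a"
proof -
  have up_a: "(a, x) \<in> N \<longleftrightarrow> (a, x) \<in> L" for x
    using assms by (auto simp: in_ext_iff)
  have *: "(x, y) \<in> N \<longleftrightarrow> (x, y) \<in> L" if "(a, x) \<in> L" for x y
    using assms L(4)[OF that] L(9)[of a] that by (auto simp: in_ext_iff)
  have "C \<in> chains_above N a \<longleftrightarrow> C \<in> chains_above L a" for C
  proof (cases "\<forall>c\<in>C. (a, c) \<in> L")
    case True
    then have "(x, y) \<in> N \<longleftrightarrow> (x, y) \<in> L" if "x \<in> C" for x y using * that by blast
    then show ?thesis by (simp add: chains_above_def Chains_def up_a)
  next
    case False
    then show ?thesis by (auto simp: chains_above_def up_a)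
  qed
  then have "chains_above N a = chains_above L a" by blast
  then show ?thesis by (simp add: dep_eq_Max)
qed

text \<open>Everything strictly above a new element is old and nonzero, so has depth at most k; a
  member of A_i on level k shows that k + 1 is attained.\<close>

lemma dep_new:
  assumes "i \<in> {n..<n + m}" shows "dep N i = Suc k"
proof (rule antisym)
  show "dep N i \<le> Suc k"
  proof (rule dep_le[OF poset_N])
    show "i < n + m" using assms by simp
    fix b assume "(i, b) \<in> N" "b \<noteq> i"
    then have "b \<in> L `` A i" using assms L(1) L(4)[of i b] by (auto simp: in_ext_iff)
    then show "dep N b < Suc k" using up(1,2)[OF assms] dep_old dep_bound by (simp add: less_Suc_eq_le)
  qed
  obtain a where a: "a \<in> A i" "a \<in> lev L k" using A_lev[OF assms] by blast
  then have "a < n" "0 < a" using A_subset[OF assms] by auto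
  moreover have "(i, a) \<in> N" using a assms L(3)[OF \<open>a < n\<close>] by (auto simp: in_ext_iff)
  ultimately have "dep N a < dep N i" using assms by (intro dep_less[OF poset_N]) auto
  then show "Suc k \<le> dep N i" using a \<open>a < n\<close> \<open>0 < a\<close> by (simp add: dep_old lev_def)
qed

text \<open>Keeps 0 off the level of the new elements: since m > 0, there is a new element strictly
  above 0, and it already has depth k + 1.\<close>

lemma dep_zero: "Suc k < dep N 0"
proof -
  have "(0, n) \<in> N" using m_pos by (simp add: in_ext_iff)
  then have "dep N n < dep N 0" using L(1) by (intro dep_less[OF poset_N]) auto
  then show ?thesis using m_pos by (simp add: dep_new)
qed

lemma dep_last: "dep N (n + m - 1) = Suc k"
  using m_pos by (intro dep_new) auto

lemma dep_eq_top_iff: "a < n + m \<Longrightarrow> dep N a = Suc k \<longleftrightarrow> n \<le> a"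
  using dep_zero dep_new[of a] dep_old[of a] dep_bound[of a] by (cases "a = 0"; cases "a < n") auto

lemma lev_top: "lev N (Suc k) = {n..n + m - 1}"
  using m_pos by (auto simp: lev_def ND(10) dep_eq_top_iff)

lemma strip_N: "strip (n + m) N = L"
proof -
  have "{a \<in> Field N. dep N a \<noteq> dep N (n + m - 1)} = {..<n}"
    unfolding dep_last by (auto simp: ND(10) dep_eq_top_iff)
  then show ?thesis using L(4) by (auto simp: strip_def in_ext_iff)
qed

text \<open>What lies strictly above i is the up-set of A_i, and the minimal elements of the up-set
  generated by an antichain are the antichain itself.\<close>

lemma cov_new:
  assumes i: "i \<in> {n..<n + m}" shows "cov N i = A i"
proof -
  have up_i: "(i, x) \<in> N \<longleftrightarrow> x = i \<or> x \<in> L `` A i" for x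
    using i L(1) L(4)[of i x] by (auto simp: in_ext_iff)
  have up_b: "(x, y) \<in> N \<longleftrightarrow> (x, y) \<in> L" if "x \<in> L `` A i" for x y
    using up[OF i that] by (auto simp: in_ext_iff)
  have ne: "i \<notin> L `` A i" using up(1)[OF i, of i] i by auto
  have sub: "A i \<subseteq> L `` A i" using A_subset[OF i] L(3) by blast
  show ?thesis
  proof (intro equalityI subsetI)
    fix b assume b: "b \<in> cov N i"
    then have "b \<in> L `` A i" by (auto simp: cov_def up_i)
    then obtain a where a: "a \<in> A i" "(a, b) \<in> L" by blast
    have "(i, a) \<in> N" "(a, b) \<in> N" "a \<noteq> i" using a sub ne up_i up_b by blast+
    then show "b \<in> A i" using b a unfolding cov_def by blast
  next
    fix b assume b: "b \<in> A i"
    have "c = b" if c: "c \<in> L `` A i" "(c, b) \<in> L" for c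
    proof -
      obtain a where a: "a \<in> A i" "(a, c) \<in> L" using c by blast
      then have "a = b" using A_antichain[OF i a(1) b] L(5) c by blast
      then show "c = b" using a c L(6) by blast
    qed
    moreover have "(i, b) \<in> N" "i \<noteq> b" using b sub ne up_i by blast+
    ultimately show "b \<in> cov N i" using up_i up_b unfolding cov_def by blast
  qed
qed

lemma cov_lev_new:
  assumes i: "i \<in> {n..<n + m}" shows "cov_lev N d i = A i \<inter> lev L d"
proof -
  have "x < n \<and> x < n + m \<and> dep N x = dep L x" if "x \<in> A i" for x
    using A_subset[OF i] that dep_old[of x] by auto
  then show ?thesis by (auto simp: cov_lev_def cov_new[OF i] lev_def ND(10) L(10))
qed

lemma levellised_N_iff: "levellised (n + m) N \<longleftrightarrow> levellised n L"
proof
  assume "levellised (n + m) N"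
  then show "levellised n L"
    unfolding levellised_def
  proof (intro allI impI)
    fix i j :: nat assume *: "\<forall>i j. 0 < i \<and> i \<le> j \<and> j < n + m \<longrightarrow> dep N i \<le> dep N j"
      and ij: "0 < i \<and> i \<le> j \<and> j < n"
    show "dep L i \<le> dep L j" using *[rule_format, of i j] ij by (simp add: dep_old)
  qed
next
  assume *: "levellised n L"
  show "levellised (n + m) N"
    unfolding levellised_def
  proof (intro allI impI)
    fix i j :: nat assume ij: "0 < i \<and> i \<le> j \<and> j < n + m"
    show "dep N i \<le> dep N j"
    proof (cases "j < n")
      case True
      then show ?thesis using ij * by (simp add: dep_old levellised_def)
    next
      case False
      then show ?thesis
        using ij dep_new[of j] dep_new[of i] dep_old[of i] dep_bound[of i] by (cases "i < n") auto
    qed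
  qed
qed

text \<open>In the locale k is only an upper bound for the depths, attained on A_n; levellisedness
  moves the maximum to the last label.\<close>

lemma dep_last_L:
  assumes "levellised n L" shows "dep L (n - 1) = k"
proof (rule antisym)
  show "dep L (n - 1) \<le> k" using dep_bound[of "n - 1"] L(1) by simp
  obtain a where a: "a \<in> A n" "dep L a = k" using A_lev[of n] m_pos by (auto simp: lev_def)
  then have "0 < a" "a \<le> n - 1" using A_subset[of n] m_pos by auto
  then show "k \<le> dep L (n - 1)" using assms a L(1) unfolding levellised_def by auto
qed

text \<open>Bridges a difference in range: \<open>strip_eq\<close> asks for agreement on all levels
  above l, whereas \<open>LWT\<close> lists levels only up to k.\<close>

lemma A_lev_above: "i \<in> {n..<n + m} \<Longrightarrow> k < d \<Longrightarrow> A i \<inter> lev L d = {}"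
  using A_subset[of i] dep_bound by (force simp: lev_def)

end

section \<open>Comparing and relabelling extensions\<close>

text \<open>The two alternatives are the two rules of \<open>lev_less\<close>, since stripping the
  extensions returns the underlying lattices and the covers of new elements on each level are the
  entries of \<open>LWT\<close>.\<close>

lemma lev_less_ext_iff:
  assumes 1: "extension n m k L\<^sub>1 A\<^sub>1" and 2: "extension n m k L\<^sub>2 A\<^sub>2"
    and lat: "n_lattice (n + m) (ext n m L\<^sub>1 A\<^sub>1)" "n_lattice (n + m) (ext n m L\<^sub>2 A\<^sub>2)"
    and lev: "levellised n L\<^sub>1" "levellised n L\<^sub>2"
    and iso: "isomorphic (n + m) (ext n m L\<^sub>1 A\<^sub>1) (ext n m L\<^sub>2 A\<^sub>2)"
  shows "lev_less (n + m) (ext n m L\<^sub>1 A\<^sub>1) (ext n m L\<^sub>2 A\<^sub>2) \<longleftrightarrow>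
    lev_less n L\<^sub>1 L\<^sub>2 \<or> L\<^sub>1 = L\<^sub>2 \<and> LWT n L\<^sub>1 m A\<^sub>1 < LWT n L\<^sub>2 m A\<^sub>2"
    (is "lev_less _ ?N1 ?N2 \<longleftrightarrow> _")
proof -
  interpret e1: extension n m k L\<^sub>1 A\<^sub>1 by (rule 1)
  interpret e2: extension n m k L\<^sub>2 A\<^sub>2 by (rule 2)
  have nm: "n + m > 2" using e1.L(1) e1.m_pos by simp
  have lev': "levellised (n + m) ?N1" "levellised (n + m) ?N2"
    using lev by (simp_all add: e1.levellised_N_iff e2.levellised_N_iff)
  have less_iff: "LWT n L\<^sub>1 m A\<^sub>1 < LWT n L\<^sub>2 m A\<^sub>2 \<longleftrightarrow>
    (\<exists>l\<in>{1..k}. \<exists>i\<in>{n..<n + m}.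
       (\<forall>d\<in>{1..k}. \<forall>j\<in>{n..<n + m}. l < d \<or> d = l \<and> j < i \<longrightarrow>
          wt (A\<^sub>1 j \<inter> lev L\<^sub>1 d) = wt (A\<^sub>2 j \<inter> lev L\<^sub>2 d)) \<and>
          wt (A\<^sub>1 i \<inter> lev L\<^sub>1 l) < wt (A\<^sub>2 i \<inter> lev L\<^sub>2 l))"
    unfolding LWT_def LWT_lev_def e1.dep_last_L[OF lev(1)] e2.dep_last_L[OF lev(2)]
    by (rule concat_map_upt_less_iff)
  have I: "{n..n + m - 1} = {n..<n + m}" using e1.m_pos by auto
  show ?thesis
  proof
    assume "lev_less (n + m) ?N1 ?N2"
    then show "lev_less n L\<^sub>1 L\<^sub>2 \<or> L\<^sub>1 = L\<^sub>2 \<and> LWT n L\<^sub>1 m A\<^sub>1 < LWT n L\<^sub>2 m A\<^sub>2"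
    proof cases
      case strip_less
      then show ?thesis by (simp add: e1.strip_N e2.strip_N e1.L(10))
    next
      case (strip_eq k' a l i)
      \<comment> \<open>The rule leaves the last level open. Here it is level k + 1 and consists of
        the new labels, so the bound \<open>k' - 1\<close> on l is k, as in
        \<open>LWT\<close>.\<close>
      have k': "k' = Suc k" using strip_eq e1.dep_last by simp
      then have "{n..n + m - 1} = {a..n + m - 1}" using strip_eq by (simp add: e1.lev_top)
      then have I': "{a..n + m - 1} = {n..<n + m}" using I by metis
      have li: "l \<in> {1..k}" "i \<in> {n..<n + m}"
        using strip_eq(11,12) unfolding k' I' by auto
      have "LWT n L\<^sub>1 m A\<^sub>1 < LWT n L\<^sub>2 m A\<^sub>2"
        unfolding less_iff
      proof (intro bexI conjI ballI impI)
        show "l \<in> {1..k}" "i \<in> {n..<n + m}" by (rule li)+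
        show "wt (A\<^sub>1 i \<inter> lev L\<^sub>1 l) < wt (A\<^sub>2 i \<inter> lev L\<^sub>2 l)"
          using strip_eq(14) li by (simp add: e1.cov_lev_new e2.cov_lev_new)
        fix d j assume j: "j \<in> {n..<n + m}" and d: "l < d \<or> d = l \<and> j < i"
        then have "j \<in> {a..n + m - 1}" using I' by simp
        then have "wt (cov_lev ?N1 d j) = wt (cov_lev ?N2 d j)"
          by (rule strip_eq(13)[rule_format, OF _ d])
        then show "wt (A\<^sub>1 j \<inter> lev L\<^sub>1 d) = wt (A\<^sub>2 j \<inter> lev L\<^sub>2 d)"
          using j by (simp add: e1.cov_lev_new e2.cov_lev_new)
      qed
      then show ?thesis using strip_eq by (simp add: e1.strip_N e2.strip_N)
    qed
  next
    assume "lev_less n L\<^sub>1 L\<^sub>2 \<or> L\<^sub>1 = L\<^sub>2 \<and> LWT n L\<^sub>1 m A\<^sub>1 < LWT n L\<^sub>2 m A\<^sub>2"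
    then show "lev_less (n + m) ?N1 ?N2"
    proof
      assume less: "lev_less n L\<^sub>1 L\<^sub>2"
      show ?thesis
        by (rule strip_less[OF nm lat(1) lev'(1) lat(2) lev'(2) iso])
          (use less in \<open>simp add: e1.strip_N e2.strip_N e1.L(10)\<close>)
    next
      assume a: "L\<^sub>1 = L\<^sub>2 \<and> LWT n L\<^sub>1 m A\<^sub>1 < LWT n L\<^sub>2 m A\<^sub>2"
      then obtain l i where li: "l \<in> {1..k}" "i \<in> {n..<n + m}"
        "wt (A\<^sub>1 i \<inter> lev L\<^sub>1 l) < wt (A\<^sub>2 i \<inter> lev L\<^sub>2 l)"
        and eq: "\<And>d j. d \<in> {1..k} \<Longrightarrow> j \<in> {n..<n + m} \<Longrightarrow> l < d \<or> d = l \<and> j < i \<Longrightarrow>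
          wt (A\<^sub>1 j \<inter> lev L\<^sub>1 d) = wt (A\<^sub>2 j \<inter> lev L\<^sub>2 d)"
        unfolding less_iff by blast
      have eq': "wt (A\<^sub>1 j \<inter> lev L\<^sub>1 d) = wt (A\<^sub>2 j \<inter> lev L\<^sub>2 d)"
        if "j \<in> {n..<n + m}" "l < d \<or> d = l \<and> j < i" for d j
      proof (cases "d \<le> k")
        case True
        then show ?thesis using that li(1) by (intro eq) auto
      next
        case False
        then show ?thesis using that by (simp add: e1.A_lev_above e2.A_lev_above)
      qed
      show ?thesis
      proof (rule strip_eq[OF nm lat(1) lev'(1) lat(2) lev'(2) iso])
        show "strip (n + m) ?N1 = strip (n + m) ?N2" unfolding e1.strip_N e2.strip_N using a ..
        show "Suc k = dep ?N1 (n + m - 1)" by (rule e1.dep_last[symmetric])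
        show "lev ?N1 (Suc k) = {n..n + m - 1}" "lev ?N2 (Suc k) = {n..n + m - 1}"
          by (rule e1.lev_top e2.lev_top)+
        show "l \<in> {1..Suc k - 1}" "i \<in> {n..n + m - 1}" using li by auto
        show "wt (cov_lev ?N1 l i) < wt (cov_lev ?N2 l i)"
          using li by (simp add: e1.cov_lev_new e2.cov_lev_new)
        show "\<forall>d. \<forall>j\<in>{n..n + m - 1}. l < d \<or> d = l \<and> j < i \<longrightarrow>
            wt (cov_lev ?N1 d j) = wt (cov_lev ?N2 d j)"
          using eq' unfolding I by (simp add: e1.cov_lev_new e2.cov_lev_new)
      qed
    qed
  qed
qed

section \<open>Relabellings of extensions\<close>

lemma Image_relabel: "inj \<sigma> \<Longrightarrow> relabel \<sigma> L `` (\<sigma> ` B) = \<sigma> ` (L `` B)"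
  by (auto simp: in_relabel_iff intro: in_relabelI elim!: in_relabelE dest: injD)

lemma relabel_Times: "relabel f (X \<times> Y) = f ` X \<times> f ` Y"
  unfolding relabel_def by force

text \<open>As \<sigma> moves only old labels and \<tau> only new ones, the new label j comes from
  \<open>inv \<tau> j\<close> and receives the \<sigma>-image of that element's antichain. This is
  the action that defines \<open>LWT_orbit\<close>.\<close>

lemma relabel_ext:
  assumes "n_poset n L" and A: "\<And>i. i \<in> {n..<n + m} \<Longrightarrow> A i \<subseteq> {..<n} - {0}"
    and \<sigma>: "\<sigma> permutes {..<n}" "\<sigma> 0 = 0" and \<tau>: "\<tau> permutes {n..<n + m}"
  shows "relabel (\<sigma> \<circ> \<tau>) (ext n m L A) = ext n m (relabel \<sigma> L) (\<lambda>j. \<sigma> ` A (inv \<tau> j))"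
proof -
  note D = n_posetD[OF assms(1)]
  have old: "(\<sigma> \<circ> \<tau>) x = \<sigma> x" if "x < n" for x
    using permutes_not_in[OF \<tau>, of x] that by simp
  have new: "(\<sigma> \<circ> \<tau>) i = \<tau> i" if "i \<in> {n..<n + m}" for i
    using permutes_not_in[OF \<sigma>(1), of "\<tau> i"] permutes_in_image[OF \<tau>, of i] that by auto
  have I: "\<tau> ` {n..<n + m} = {n..<n + m}" using permutes_image[OF \<tau>] .
  have "relabel (\<sigma> \<circ> \<tau>) L = relabel \<sigma> L"
    using old by (intro relabel_cong) (auto simp: D(10))
  moreover have "relabel (\<sigma> \<circ> \<tau>) ({0} \<times> {n..<n + m}) = {0} \<times> {n..<n + m}"
  proof -
    have "relabel (\<sigma> \<circ> \<tau>) ({0} \<times> {n..<n + m}) = {(\<sigma> \<circ> \<tau>) 0} \<times> (\<sigma> \<circ> \<tau>) ` {n..<n + m}"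
      by (simp add: relabel_Times)
    also have "(\<sigma> \<circ> \<tau>) ` {n..<n + m} = {n..<n + m}" using new I by (metis (no_types, lifting) image_cong)
    also have "(\<sigma> \<circ> \<tau>) 0 = 0" using old[of 0] D(1) \<sigma>(2) by simp
    finally show ?thesis .
  qed
  moreover have "relabel (\<sigma> \<circ> \<tau>) (\<Union>i\<in>{n..<n + m}. {i} \<times> insert i (L `` A i)) =
      (\<Union>j\<in>{n..<n + m}. {j} \<times> insert j (relabel \<sigma> L `` (\<sigma> ` A (inv \<tau> j))))"
  proof -
    have "relabel (\<sigma> \<circ> \<tau>) ({i} \<times> insert i (L `` A i)) =
        {\<tau> i} \<times> insert (\<tau> i) (relabel \<sigma> L `` (\<sigma> ` A (inv \<tau> (\<tau> i))))" if i: "i \<in> {n..<n + m}" for i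
    proof -
      have "(\<sigma> \<circ> \<tau>) ` (L `` A i) = \<sigma> ` (L `` A i)"
        using old up_set_nonzero(1)[OF assms(1) A[OF i]] by (intro image_cong) auto
      moreover have "relabel (\<sigma> \<circ> \<tau>) ({i} \<times> insert i (L `` A i)) =
          {(\<sigma> \<circ> \<tau>) i} \<times> insert ((\<sigma> \<circ> \<tau>) i) ((\<sigma> \<circ> \<tau>) ` (L `` A i))"
        by (simp only: relabel_Times image_insert image_empty)
      ultimately show ?thesis
        using new[OF i] permutes_inverses(2)[OF \<tau>] permutes_inj[OF \<sigma>(1)] by (simp add: Image_relabel)
    qed
    then have "relabel (\<sigma> \<circ> \<tau>) (\<Union>i\<in>{n..<n + m}. {i} \<times> insert i (L `` A i)) =
      (\<Union>i\<in>{n..<n + m}. {\<tau> i} \<times> insert (\<tau> i) (relabel \<sigma> L `` (\<sigma> ` A (inv \<tau> (\<tau> i)))))"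
      unfolding relabel_def image_UN by (intro SUP_cong) auto
    \<comment> \<open>Reindexing by j = \<tau> i, where \<tau> permutes the new labels.\<close>
    also have "\<dots> = (\<Union>j\<in>\<tau> ` {n..<n + m}. {j} \<times> insert j (relabel \<sigma> L `` (\<sigma> ` A (inv \<tau> j))))"
      by (simp only: image_image)
    finally show ?thesis unfolding I .
  qed
  ultimately show ?thesis unfolding ext_def by (simp only: relabel_def image_Un)
qed

context extension begin

lemma extension_relabel:
  assumes \<sigma>: "\<sigma> permutes {..<n}" "\<sigma> 0 = 0" "\<sigma> 1 = 1" and \<tau>: "\<tau> permutes {n..<n + m}"
  shows "extension n m k (relabel \<sigma> L) (\<lambda>j. \<sigma> ` A (inv \<tau> j))"
proof
  have inj: "inj \<sigma>" and bij: "bij \<sigma>" using \<sigma>(1) permutes_inj permutes_bij by auto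
  have inv: "inv \<tau> i \<in> {n..<n + m}" if "i \<in> {n..<n + m}" for i
    using that permutes_in_image[OF permutes_inv[OF \<tau>]] by blast
  show "n_poset n (relabel \<sigma> L)" using poset \<sigma> by (rule n_poset_relabel)
  show "0 < m" by (rule m_pos)
  fix i assume i: "i \<in> {n..<n + m}"
  show "\<sigma> ` A (inv \<tau> i) \<subseteq> {..<n} - {0}"
  proof
    fix x assume "x \<in> \<sigma> ` A (inv \<tau> i)"
    then obtain a where a: "a \<in> A (inv \<tau> i)" "x = \<sigma> a" by blast
    then have "a < n" "a \<noteq> 0" using A_subset[OF inv[OF i]] by auto
    then show "x \<in> {..<n} - {0}"
      using a permutes_in_image[OF \<sigma>(1), of a] \<sigma>(2) inj by (auto dest: injD[of \<sigma> a 0])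
  qed
  show "a = b" if "a \<in> \<sigma> ` A (inv \<tau> i)" "b \<in> \<sigma> ` A (inv \<tau> i)" "(a, b) \<in> relabel \<sigma> L" for a b
    using that A_antichain[OF inv[OF i]] by (metis (no_types) imageE in_relabel_iff[OF inj])
  show "\<sigma> ` A (inv \<tau> i) \<inter> lev (relabel \<sigma> L) k \<noteq> {}"
    using A_lev[OF inv[OF i]] by (auto simp: lev_relabel[OF bij \<sigma>(3)])
next
  fix j assume j: "0 < j" "j < n"
  then obtain x where x: "j = \<sigma> x" "x < n" using permutes_image[OF \<sigma>(1)] by auto
  then have "0 < x" using j \<sigma>(2) by (cases x) auto
  then show "dep (relabel \<sigma> L) j \<le> k"
    using x dep_bound dep_relabel[OF permutes_bij[OF \<sigma>(1)] \<sigma>(3)] by simp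
qed

text \<open>If a new element received an old label, then by counting an old element would receive a new,
  larger label although its depth is smaller.\<close>

lemma levellised_relabelling_splits:
  assumes \<pi>: "\<pi> permutes {..<n + m}"
    and K: "n_poset (n + m) (relabel \<pi> N)" "levellised (n + m) (relabel \<pi> N)"
  obtains \<sigma> \<tau> where "\<sigma> permutes {..<n}" "\<sigma> 0 = 0" "\<sigma> 1 = 1" "\<tau> permutes {n..<n + m}" "\<pi> = \<sigma> \<circ> \<tau>"
proof -
  note fix01 = permutes_fixes_bounds[OF poset_N K(1) \<pi>]
  have inj: "inj \<pi>" using \<pi> by (rule permutes_inj)
  have dep: "dep (relabel \<pi> N) (\<pi> a) = dep N a" for a
    by (rule dep_relabel[OF permutes_bij[OF \<pi>] fix01(2)])
  have lt: "\<pi> x < n + m \<longleftrightarrow> x < n + m" for x using permutes_in_image[OF \<pi>, of x] by simp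
  have "\<pi> ` {n..<n + m} \<subseteq> {n..<n + m}"
  proof safe
    fix i assume i: "i \<in> {n..<n + m}"
    have "n \<le> \<pi> i"
    proof (rule ccontr)
      assume *: "\<not> n \<le> \<pi> i"
      \<comment> \<open>Pigeonhole: otherwise \<pi> would map the n + 1 elements of
        \<open>insert i {..<n}\<close> injectively into n labels.\<close>
      obtain a where a: "a < n" "n \<le> \<pi> a"
      proof (rule ccontr)
        assume "\<not> thesis"
        then have "\<pi> ` insert i {..<n} \<subseteq> {..<n}" using * that by force
        then have "card (\<pi> ` insert i {..<n}) \<le> n" using card_mono[of "{..<n}"] by simp
        then show False
          using i card_image[OF inj_on_subset[OF inj], of "insert i {..<n}"] by simp
      qed
      have "a \<noteq> 0" using a fix01(1) by (cases a) auto
      then have "dep N a \<le> k" using a dep_old dep_bound by simp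
      \<comment> \<open>Levellisedness compares nonzero labels only, so 0 has to be excluded before
        it is applied to \<pi> i < \<pi> a.\<close>
      have "\<pi> i \<noteq> 0" using i fix01(1) L(1) injD[OF inj, of i 0] by auto
      then have "dep N i \<le> dep N a"
        using K(2)[unfolded levellised_def, rule_format, of "\<pi> i" "\<pi> a"] a * lt[of a] by (simp add: dep)
      then show False using dep_new[OF i] \<open>dep N a \<le> k\<close> by simp
    qed
    then show "\<pi> i \<in> {n..<n + m}" using i lt[of i] by simp
  qed
  then have new: "\<pi> ` {n..<n + m} = {n..<n + m}"
    using inj by (intro endo_inj_surj) (auto intro: inj_on_subset)
  have "{..<n + m} - {n..<n + m} = {..<n}" by auto
  then have old: "\<pi> ` {..<n} = {..<n}"
    using permutes_image[OF \<pi>] new image_set_diff[OF inj, of "{..<n + m}" "{n..<n + m}"] by simp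
  define \<sigma> where "\<sigma> x = (if x < n then \<pi> x else x)" for x
  define \<tau> where "\<tau> x = (if n \<le> x then \<pi> x else x)" for x
  have "bij_betw \<pi> {..<n} {..<n}" "bij_betw \<pi> {n..<n + m} {n..<n + m}"
    using inj old new by (auto simp: bij_betw_def intro: inj_on_subset)
  then have b: "bij_betw \<sigma> {..<n} {..<n}" "bij_betw \<tau> {n..<n + m} {n..<n + m}"
    by (subst bij_betw_cong[of _ _ \<pi>]; simp add: \<sigma>_def \<tau>_def)+
  show thesis
  proof
    show "\<sigma> permutes {..<n}" using b(1) by (rule bij_imp_permutes) (simp add: \<sigma>_def)
    show "\<tau> permutes {n..<n + m}"
      using b(2) by (rule bij_imp_permutes) (use permutes_not_in[OF \<pi>] in \<open>auto simp: \<tau>_def\<close>)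
    show "\<sigma> 0 = 0" "\<sigma> 1 = 1" using L(1) fix01 by (auto simp: \<sigma>_def)
    show "\<pi> = \<sigma> \<circ> \<tau>"
    proof
      fix x
      have "n \<le> \<pi> x" if "n \<le> x"
        using that new permutes_not_in[OF \<pi>, of x] by (cases "x < n + m") auto
      then show "\<pi> x = (\<sigma> \<circ> \<tau>) x" by (auto simp: \<sigma>_def \<tau>_def)
    qed
  qed
qed

end

section \<open>Canonicity of the extension\<close>

theorem theorem3p14:
  fixes n m k :: nat and L :: "nat rel" and A :: "nat \<Rightarrow> nat set"
  assumes "n_lattice n L" and "levellised n L"
    and "dep L (n - 1) = k"
    and "m > 0"
    and "\<And>i. i \<in> {n..<n + m} \<Longrightarrow> A i \<subseteq> {..<n} - {0}"
    and "\<And>i. i \<in> {n..<n + m} \<Longrightarrow> A i \<inter> lev L k \<noteq> {}"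
    and "\<And>i. i \<in> {n..<n + m} \<Longrightarrow> lattice_antichain L (A i)"
    and "\<And>i j a b. n \<le> i \<Longrightarrow> i < j \<Longrightarrow> j < n + m \<Longrightarrow>
           a \<in> up_set L (A i) \<inter> up_set L (A j) \<Longrightarrow> b \<in> up_set L (A i) \<inter> up_set L (A j) \<Longrightarrow>
           meet_in L a b \<noteq> 0"
  shows "canonical (n + m) (add_elems n L A m) \<longleftrightarrow>
           canonical n L \<and> (\<forall>s\<in>LWT_orbit n L m A. LWT n L m A \<le> s)"
proof -
  have P: "n_poset n L" using assms(1) by (simp add: n_lattice_def)
  interpret extension n m k L A
  proof
    show "dep L j \<le> k" if "0 < j" "j < n" for j
      using that assms(2,3) unfolding levellised_def by auto
    show "a = b" if "i \<in> {n..<n + m}" "a \<in> A i" "b \<in> A i" "(a, b) \<in> L" for i a b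
      using assms(7)[OF that(1)] that by (auto simp: lattice_antichain_def)
  qed (use P assms(4-6) in blast)+
  have add: "add_elems n L A m = N"
    using assms(5,6) by (intro add_elems_eq_ext P) blast+
  have latN: "n_lattice (n + m) N"
    using assms(1,5,7,8) by (rule n_lattice_ext)
  have levN: "levellised (n + m) N" using assms(2) by (simp add: levellised_N_iff)
  let ?B = "\<lambda>\<sigma> \<tau> j. \<sigma> ` A (inv \<tau> j)"
  have K: "relabel (\<sigma> \<circ> \<tau>) N = ext n m (relabel \<sigma> L) (?B \<sigma> \<tau>)"
      "levellised (n + m) (relabel (\<sigma> \<circ> \<tau>) N) \<longleftrightarrow> levellised n (relabel \<sigma> L)"
      "isomorphic (n + m) N (relabel (\<sigma> \<circ> \<tau>) N)"
      "n_lattice (n + m) (relabel (\<sigma> \<circ> \<tau>) N)"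
      "levellised n (relabel \<sigma> L) \<Longrightarrow> lev_less (n + m) (relabel (\<sigma> \<circ> \<tau>) N) N \<longleftrightarrow>
        lev_less n (relabel \<sigma> L) L \<or> relabel \<sigma> L = L \<and> LWT n L m (?B \<sigma> \<tau>) < LWT n L m A"
    if \<sigma>: "\<sigma> permutes {..<n}" "\<sigma> 0 = 0" "\<sigma> 1 = 1" and \<tau>: "\<tau> permutes {n..<n + m}" for \<sigma> \<tau>
  proof -
    show eq: "relabel (\<sigma> \<circ> \<tau>) N = ext n m (relabel \<sigma> L) (?B \<sigma> \<tau>)"
      using P assms(5) \<sigma>(1,2) \<tau> by (rule relabel_ext)
    have e: "extension n m k (relabel \<sigma> L) (?B \<sigma> \<tau>)" using that by (rule extension_relabel)
    show "levellised (n + m) (relabel (\<sigma> \<circ> \<tau>) N) \<longleftrightarrow> levellised n (relabel \<sigma> L)"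
      unfolding eq by (rule extension.levellised_N_iff[OF e])
    have \<pi>: "\<sigma> \<circ> \<tau> permutes {..<n + m}"
      using permutes_subset[OF \<sigma>(1), of "{..<n + m}"] permutes_subset[OF \<tau>, of "{..<n + m}"]
      by (intro permutes_compose) (auto simp: subset_iff)
    show iso: "isomorphic (n + m) N (relabel (\<sigma> \<circ> \<tau>) N)"
      using \<pi> by (auto simp: isomorphic_def)
    \<comment> \<open>The relabelled extension is a lattice as an image of \<open>N\<close>; the
      meet conditions are not transported to the relabelled antichains.\<close>
    have "\<tau> 0 = 0" "\<tau> 1 = 1" using permutes_not_in[OF \<tau>] L(1) by auto
    then show lat: "n_lattice (n + m) (relabel (\<sigma> \<circ> \<tau>) N)"
      using \<sigma> by (intro n_lattice_relabel latN \<pi>) auto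
    show "lev_less (n + m) (relabel (\<sigma> \<circ> \<tau>) N) N \<longleftrightarrow>
        lev_less n (relabel \<sigma> L) L \<or> relabel \<sigma> L = L \<and> LWT n L m (?B \<sigma> \<tau>) < LWT n L m A"
      if "levellised n (relabel \<sigma> L)"
      using lev_less_ext_iff[OF e extension_axioms lat[unfolded eq] latN that assms(2)
          isomorphic_sym[OF iso, unfolded eq]]
      by (auto simp: eq)
  qed
  show ?thesis
    unfolding add
  proof (intro iffI conjI ballI)
    assume can: "canonical (n + m) N"
    \<comment> \<open>A smaller relabelling of L, or a smaller sequence for the same L, would give a
      levellised relabelling of \<open>N\<close> below \<open>N\<close>.\<close>
    have no: False
      if "\<sigma> permutes {..<n}" "\<sigma> 0 = 0" "\<sigma> 1 = 1" "\<tau> permutes {n..<n + m}" "levellised n (relabel \<sigma> L)"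
        "lev_less n (relabel \<sigma> L) L \<or> relabel \<sigma> L = L \<and> LWT n L m (?B \<sigma> \<tau>) < LWT n L m A" for \<sigma> \<tau>
      using can K[OF that(1-4)] that(5,6) unfolding canonical_def by blast
    show "canonical n L"
      unfolding canonical_def
    proof (intro conjI notI assms(1,2))
      assume "\<exists>K. n_lattice n K \<and> levellised n K \<and> isomorphic n L K \<and> lev_less n K L"
      then obtain \<sigma> where \<sigma>: "\<sigma> permutes {..<n}" and lat: "n_lattice n (relabel \<sigma> L)"
        and lev: "levellised n (relabel \<sigma> L)" and less: "lev_less n (relabel \<sigma> L) L"
        by (auto simp: isomorphic_def)
      have P': "n_poset n (relabel \<sigma> L)" using lat by (simp add: n_lattice_def)
      \<comment> \<open>A relabelling of L alone is extended to \<open>N\<close> by taking \<tau> to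
        be the identity.\<close>
      show False
        using no[OF \<sigma> permutes_fixes_bounds[OF P P' \<sigma>] permutes_id lev disjI1[OF less]] .
    qed
    fix s assume "s \<in> LWT_orbit n L m A"
    then obtain \<sigma> \<tau> where s: "s = LWT n L m (?B \<sigma> \<tau>)" and \<sigma>: "\<sigma> permutes {..<n}" "relabel \<sigma> L = L"
      and \<tau>: "\<tau> permutes {n..<n + m}"
      unfolding LWT_orbit_def Stab_def by blast
    have "\<sigma> 0 = 0" "\<sigma> 1 = 1" using permutes_fixes_bounds[OF P _ \<sigma>(1)] \<sigma>(2) P by auto
    then have "\<not> s < LWT n L m A" using no[of \<sigma> \<tau>] \<sigma> \<tau> assms(2) s by auto
    then show "LWT n L m A \<le> s" by simp
  next
    assume min: "canonical n L \<and> (\<forall>s\<in>LWT_orbit n L m A. LWT n L m A \<le> s)"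
    show "canonical (n + m) N"
      unfolding canonical_def
    proof (intro conjI notI latN levN)
      assume "\<exists>K. n_lattice (n + m) K \<and> levellised (n + m) K \<and> isomorphic (n + m) N K \<and>
        lev_less (n + m) K N"
      then obtain \<pi> where \<pi>: "\<pi> permutes {..<n + m}" and lat: "n_lattice (n + m) (relabel \<pi> N)"
        and lev: "levellised (n + m) (relabel \<pi> N)" and less: "lev_less (n + m) (relabel \<pi> N) N"
        by (auto simp: isomorphic_def)
      have "n_poset (n + m) (relabel \<pi> N)" using lat by (simp add: n_lattice_def)
      from levellised_relabelling_splits[OF \<pi> this lev]
      obtain \<sigma> \<tau> where \<sigma>: "\<sigma> permutes {..<n}" "\<sigma> 0 = 0" "\<sigma> 1 = 1" and \<tau>: "\<tau> permutes {n..<n + m}"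
        and eq: "\<pi> = \<sigma> \<circ> \<tau>" .
      have lev': "levellised n (relabel \<sigma> L)" using lev K(2)[OF \<sigma> \<tau>] eq by simp
      have "lev_less n (relabel \<sigma> L) L \<or> relabel \<sigma> L = L \<and> LWT n L m (?B \<sigma> \<tau>) < LWT n L m A"
        using less K(5)[OF \<sigma> \<tau> lev'] eq by simp
      then show False
      proof
        assume "lev_less n (relabel \<sigma> L) L"
        moreover have "n_lattice n (relabel \<sigma> L)" using assms(1) \<sigma> by (rule n_lattice_relabel)
        moreover have "isomorphic n L (relabel \<sigma> L)" using \<sigma> by (auto simp: isomorphic_def)
        ultimately show False using min lev' unfolding canonical_def by blast
      next
        assume a: "relabel \<sigma> L = L \<and> LWT n L m (?B \<sigma> \<tau>) < LWT n L m A"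
        then have "LWT n L m (?B \<sigma> \<tau>) \<in> LWT_orbit n L m A"
          using \<sigma> \<tau> unfolding LWT_orbit_def Stab_def by blast
        then show False using min a by (meson not_less)
      qed
    qed
  qed
qed

end
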